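(* Let $p$ be a prime with $p\neq 2$ and let $n\in\mathbb{N}$, $n\geq 1$. Then the graph $\Gamma(\mathbb{Z}_{p^n})$ has irrational eigenvalues, i.e. the adjacency matrix of $\Gamma(\mathbb{Z}_{p^n})$ has at least one irrational eigenvalue.
   Context: For a finite group $G$, the prime order element graph $\Gamma(G)$ is the simple undirected graph with vertex set $G$ in which two distinct vertices $x,y\in G$ are adjacent if and only if the order of the product $xy$ (the sum $x+y$ if $G$ is written additively) is a prime number. $\mathbb{Z}_m$ denotes the cyclic group of order $m$. Eigenvalues of a graph are the eigenvalues of its adjacency matrix. *)

theory Defs
  imports
    "HOL-Computational_Algebra.Primes"
    "HOL-Algebra.Elementary_Groups"
    "HOL-Algebra.Multiplicative_Group"
    "Graph_Theory.Pair_Digraph"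
    "Jordan_Normal_Form.Char_Poly"
begin

text \<open>Undirected simple graphs are represented, as in Graph_Theory, by finite symmetric
  loop-free digraphs without parallel arcs (\<open>pair_graph\<close>): an edge between \<open>x\<close> and \<open>y\<close> is the
  pair of arcs \<open>(x, y)\<close> and \<open>(y, x)\<close>.\<close>

definition prime_order_graph :: "('a, 'b) monoid_scheme \<Rightarrow> 'a pair_pre_digraph" where
  "prime_order_graph G =
     \<lparr> pverts = carrier G,
       parcs = {(x, y). x \<in> carrier G \<and> y \<in> carrier G \<and> x \<noteq> y \<and>
                        Factorial_Ring.prime (group.ord G (x \<otimes>\<^bsub>G\<^esub> y))} \<rparr>"

text \<open>The adjacency matrix with respect to an enumeration \<open>vs\<close> of the vertices, which is intended
  to be distinct and to exhaust the vertex set.\<close>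

definition adjacency_mat :: "'a pair_pre_digraph \<Rightarrow> 'a list \<Rightarrow> real mat" where
  "adjacency_mat \<Gamma> vs =
     mat (length vs) (length vs) (\<lambda>(i, j). if (vs ! i, vs ! j) \<in> parcs \<Gamma> then 1 else 0)"

text \<open>For noncommutative groups symmetry uses that \<open>x \<otimes> y\<close> and \<open>y \<otimes> x\<close> are conjugate, hence of
  equal order.\<close>

lemma (in group) ord_mult_commute:
  assumes x: "x \<in> carrier G" and y: "y \<in> carrier G"
  shows "ord (x \<otimes> y) = ord (y \<otimes> x)"
proof -
  have *: "(b \<otimes> a) [^] k = \<one>"
    if a: "a \<in> carrier G" and b: "b \<in> carrier G" and one: "(a \<otimes> b) [^] k = \<one>"
    for a b and k :: nat
  proof -
    have "(b \<otimes> a) [^] k \<otimes> b = b \<otimes> (a \<otimes> b) [^] k"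
      using a b by (induction k) (simp_all add: m_assoc flip: nat_pow_Suc2, metis m_assoc m_closed nat_pow_closed)
    then show ?thesis
      using a b one by (simp add: r_cancel_one)
  qed
  show ?thesis
    using x y * by (intro dvd_antisym) (metis m_closed pow_eq_id pow_ord_eq_1)+
qed

lemma pair_graph_prime_order_graph:
  assumes "group G" and "finite (carrier G)"
  shows "pair_graph (prime_order_graph G)"
proof -
  interpret group G by fact
  have sub: "parcs (prime_order_graph G) \<subseteq> carrier G \<times> carrier G"
    by (auto simp: prime_order_graph_def)
  have fin: "finite (parcs (prime_order_graph G))"
    by (rule finite_subset[OF sub]) (simp add: assms(2))
  have sym: "sym (parcs (prime_order_graph G))"
    by (auto simp: prime_order_graph_def sym_def ord_mult_commute)
  show ?thesis
    using sub fin sym assms(2)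
    by unfold_locales
      (auto simp: prime_order_graph_def symmetric_def arcs_ends_def arc_to_ends_def with_proj_def image_def)
qed

end

theory Submission
  imports Defs
begin

text \<open>Let \<open>q = p ^ (n - 1)\<close>. The elements of prime order in \<open>\<int> / p ^ n\<close> are the nonzero multiples
  of \<open>q\<close>, so the subgroup of order \<open>p\<close> is a union of connected components of the graph. In it,
  \<open>0\<close> is adjacent to all other vertices, and any other \<open>x\<close> is adjacent to all vertices but
  \<open>\<plusminus>x\<close>. A function that is \<open>a\<close> at \<open>0\<close>, \<open>1\<close> on the rest of the subgroup and \<open>0\<close> elsewhere is therefore an
  eigenvector for \<open>k\<close> iff \<open>k a = p - 1\<close> and \<open>k = a + p - 3\<close>, that is
  \<open>2 k = p - 3 \<plusminus> sqrt ((p - 1)\<^sup>2 + 4)\<close>. No square exceeds a positive square by \<open>4\<close>.\<close>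

text \<open>Lets eigenvectors be given as functions on the vertices. Since \<open>vs\<close> is
  distinct, indices correspond bijectively to vertices, so an entry of the matrix-vector product is
  a sum over neighbours.\<close>

lemma eigenvalue_adjacency_matI:
  fixes f :: "'a \<Rightarrow> real"
  assumes "distinct vs"
    and nz: "x0 \<in> set vs" "f x0 \<noteq> 0"
    and eq: "\<And>x. x \<in> set vs \<Longrightarrow> (\<Sum>y | y \<in> set vs \<and> (x, y) \<in> parcs \<Gamma>. f y) = k * f x"
  shows "eigenvalue (adjacency_mat \<Gamma> vs) k"
proof -
  let ?v = "vec (length vs) (\<lambda>i. f (vs ! i))"
  have "adjacency_mat \<Gamma> vs *\<^sub>v ?v = k \<cdot>\<^sub>v ?v"
  proof (rule eq_vecI)
    fix i assume "i < dim_vec (k \<cdot>\<^sub>v ?v)"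
    then have i: "i < length vs" by simp
    let ?g = "\<lambda>y. (if (vs ! i, y) \<in> parcs \<Gamma> then 1 else 0) * f y"
    have "(adjacency_mat \<Gamma> vs *\<^sub>v ?v) $ i = (\<Sum>j = 0..<length vs. ?g (vs ! j))"
      using i by (simp add: adjacency_mat_def scalar_prod_def)
    also have "\<dots> = (\<Sum>y\<in>set vs. ?g y)"
      using bij_betw_nth[OF assms(1), of "{0..<length vs}" "set vs"]
      by (intro sum.reindex_bij_betw) (simp add: atLeast0LessThan)
    also have "\<dots> = (\<Sum>y | y \<in> set vs \<and> (vs ! i, y) \<in> parcs \<Gamma>. f y)"
      by (rule sum.mono_neutral_cong_right) auto
    also have "\<dots> = (k \<cdot>\<^sub>v ?v) $ i"
      using i eq[of "vs ! i"] by simp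
    finally show "(adjacency_mat \<Gamma> vs *\<^sub>v ?v) $ i = (k \<cdot>\<^sub>v ?v) $ i" .
  qed (simp add: adjacency_mat_def)
  moreover have "?v \<noteq> 0\<^sub>v (length vs)"
  proof
    assume 0: "?v = 0\<^sub>v (length vs)"
    obtain i where i: "i < length vs" "vs ! i = x0"
      using nz by (auto simp: in_set_conv_nth)
    then show False
      using arg_cong[OF 0, of "\<lambda>v. v $ i"] nz by simp
  qed
  ultimately have "eigenvector (adjacency_mat \<Gamma> vs) ?v k"
    by (simp add: eigenvector_def adjacency_mat_def)
  then show ?thesis
    unfolding eigenvalue_def by blast
qed

text \<open>\<open>ord z\<close> divides \<open>k\<close> iff \<open>p ^ Suc n\<close> divides
  \<open>k * z\<close>. So \<open>ord z\<close> always divides \<open>p ^ Suc n\<close>, which makes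
  \<open>p\<close> its only possible prime value, and it divides \<open>p\<close> iff
  \<open>p ^ n\<close> divides \<open>z\<close>.\<close>

lemma prime_ord_integer_mod_group_iff:
  fixes p n :: nat and z :: int
  assumes p: "Factorial_Ring.prime p" and z: "z \<in> carrier (integer_mod_group (p ^ Suc n))"
  shows "Factorial_Ring.prime (group.ord (integer_mod_group (p ^ Suc n)) z)
           \<longleftrightarrow> z \<noteq> 0 \<and> int p ^ n dvd z"
proof -
  let ?G = "integer_mod_group (p ^ Suc n)"
  interpret group ?G by simp
  have pos: "p > 0" using p by (rule prime_gt_0_nat)
  have dvd_iff: "ord z dvd k \<longleftrightarrow> int p ^ Suc n dvd int k * z" for k
    using pow_eq_id[OF z, of k] by (simp add: mod_eq_0_iff_dvd)
  have ord_p: "ord z dvd p \<longleftrightarrow> int p ^ n dvd z"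
    using pos unfolding dvd_iff by simp
  have ord_1: "ord z = 1 \<longleftrightarrow> z = 0"
    using ord_eq_1[OF z] by simp
  have ord_pn: "ord z dvd p ^ Suc n"
    unfolding dvd_iff by simp
  show ?thesis
  proof
    assume pr: "Factorial_Ring.prime (ord z)"
    then have "ord z dvd p"
      using ord_pn prime_dvd_power by blast
    then show "z \<noteq> 0 \<and> int p ^ n dvd z"
      using ord_p ord_1 pr by auto
  next
    assume "z \<noteq> 0 \<and> int p ^ n dvd z"
    then have "ord z = p"
      using ord_p ord_1 p prime_nat_iff by blast
    with p show "Factorial_Ring.prime (ord z)" by simp
  qed
qed

text \<open>The root is an algebraic integer, so if rational it is an integer \<open>s > r\<close>.
  Then \<open>s ^ 2\<close> is at least \<open>(r + 1) ^ 2 = r ^ 2 + 2 * r + 1\<close>, which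
  exceeds \<open>r ^ 2 + 4\<close> once \<open>r \<ge> 2\<close>.\<close>

lemma sqrt_square_plus_4_irrational:
  fixes r :: nat
  assumes "r \<ge> 2"
  shows "sqrt (real r ^ 2 + 4) \<notin> \<rat>"
proof
  assume "sqrt (real r ^ 2 + 4) \<in> \<rat>"
  moreover have "algebraic_int (sqrt (real (r ^ 2 + 4)))"
    by (intro algebraic_int_sqrt algebraic_int_of_nat)
  ultimately have "sqrt (real r ^ 2 + 4) \<in> \<int>"
    by (intro rational_algebraic_int_is_int) simp_all
  then obtain s where s: "sqrt (real r ^ 2 + 4) = of_int s"
    by (elim Ints_cases)
  have "real_of_int (s ^ 2) = real_of_int (int r ^ 2 + 4)"
    by (simp flip: s)
  then have sq: "s ^ 2 = int r ^ 2 + 4"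
    by (simp only: of_int_eq_iff)
  have "real_of_int s \<ge> 0"
    unfolding s[symmetric] by simp
  then have "s \<ge> 0" by simp
  moreover have "int r ^ 2 < s ^ 2"
    unfolding sq by simp
  ultimately have "int r < s"
    by (rule power_less_imp_less_base[rotated])
  then have "(int r + 1) ^ 2 \<le> s ^ 2"
    by (intro power_mono) auto
  with sq assms show False
    by (simp add: power2_eq_square algebra_simps)
qed

theorem theorem2p3:
  fixes p n :: nat and vs :: "int list"
  assumes "Factorial_Ring.prime p" and "p \<noteq> 2" and "n \<ge> 1"
    and "distinct vs"
    and "set vs = pverts (prime_order_graph (integer_mod_group (p ^ n)))"
  shows "\<exists>k. eigenvalue (adjacency_mat (prime_order_graph (integer_mod_group (p ^ n))) vs) k
             \<and> k \<notin> \<rat>"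
proof -
  obtain n' where n': "n = Suc n'"
    using assms(3) by (cases n) auto
  define q where "q = int p ^ n'"
  define \<Gamma> where "\<Gamma> = prime_order_graph (integer_mod_group (p ^ n))"
  define m where "m = int p * q"
  have p3: "p \<ge> 3"
    using assms(1,2) prime_ge_2_nat[of p] by simp
  have "odd p"
    using assms(1,2) primes_dvd_imp_eq two_is_prime_nat by blast
  then have "odd m" and q: "q > 0" and m: "m > 0" and qm: "q dvd m"
    using p3 by (simp_all add: m_def q_def)
  have pn: "int (p ^ n) = m"
    by (simp add: n' m_def q_def)
  have car: "carrier (integer_mod_group (p ^ n)) = {0..<m}"
    using p3 pn by (simp add: carrier_integer_mod_group)
  have vs: "set vs = {0..<m}"
    using assms(5) car by (simp add: prime_order_graph_def)
  \<comment> \<open>The group operation is addition modulo \<open>m\<close>. As \<open>q\<close>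
    divides \<open>m\<close>, the reduction does not affect divisibility by
    \<open>q\<close>.\<close>
  have arcs: "(x, y) \<in> parcs \<Gamma> \<longleftrightarrow> x \<noteq> y \<and> \<not> m dvd x + y \<and> q dvd x + y"
    if "x \<in> {0..<m}" "y \<in> {0..<m}" for x y
  proof -
    have "(x + y) mod m \<in> carrier (integer_mod_group (p ^ Suc n'))"
      using m car n' by simp
    from prime_ord_integer_mod_group_iff[OF assms(1) this] that pn car
    show ?thesis
      using dvd_mod_iff[OF qm, of "x + y"]
      by (auto simp: \<Gamma>_def prime_order_graph_def n' mod_eq_0_iff_dvd simp flip: q_def)
  qed

  define S where "S = {y \<in> {0..<m}. q dvd y}"
  have "S = (\<lambda>j. q * int j) ` {0..<p}"
  proof (intro equalityI subsetI)
    fix y assume y: "y \<in> S"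
    then obtain j where j: "y = q * j"
      unfolding S_def by blast
    with y have "0 \<le> q * j" "q * j < q * int p"
      by (simp_all add: S_def m_def mult.commute)
    then have "0 \<le> j" "j < int p"
      using q by (simp_all add: zero_le_mult_iff)
    then show "y \<in> (\<lambda>j. q * int j) ` {0..<p}"
      using j by (intro image_eqI[of _ _ "nat j"]) auto
  qed (use q in \<open>auto simp: S_def m_def mult.commute\<close>)
  moreover have "inj_on (\<lambda>j. q * int j) {0..<p}"
    using q by (auto simp: inj_on_def)
  ultimately have card_S: "card S = p"
    by (simp add: card_image)
  \<comment> \<open>\<open>card\<close> is 0 on infinite sets, so \<open>card S = p > 0\<close>
    gives finiteness.\<close>
  have fin_S: "finite S" and S0: "0 \<in> S"
    using m p3 card_S card.infinite[of S] by (auto simp: S_def)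

  \<comment> \<open>Eliminating \<open>a\<close> from the two eigenvector equations leaves
    \<open>k^2 - (p - 3) k - (p - 1) = 0\<close>, whose discriminant is
    \<open>(p - 3)^2 + 4 (p - 1) = (p - 1)^2 + 4\<close>. \<open>k\<close> is the larger
    root.\<close>
  define D where "D = sqrt (real (p - 1) ^ 2 + 4)"
  define k where "k = (real p - 3 + D) / 2"
  define a where "a = k - (real p - 3)"
  define f where "f y = (if y = 0 then a else if y \<in> S then 1 else 0)" for y
  have "D ^ 2 = (real p - 1) ^ 2 + 4"
    using p3 by (simp add: D_def of_nat_diff)
  then have ka: "k * a = real p - 1"
    by (simp add: k_def a_def power2_eq_square field_simps)
  have D: "D \<notin> \<rat>"
    using p3 sqrt_square_plus_4_irrational[of "p - 1"] by (simp add: D_def)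
  have irr: "k \<notin> \<rat>"
  proof
    assume "k \<in> \<rat>"
    then have "2 * k - (of_nat p - 3) \<in> \<rat>" by simp
    moreover have "2 * k - (of_nat p - 3) = D"
      by (simp add: k_def field_simps)
    ultimately show False using D by simp
  qed
  have sum_rest: "sum f (S - {0}) = real p - 1"
  proof -
    have "sum f (S - {0}) = (\<Sum>y\<in>S - {0}. 1)"
      by (rule sum.cong) (auto simp: f_def)
    then show ?thesis
      using fin_S S0 card_S p3 by (simp add: of_nat_diff)
  qed

  have "(\<Sum>y | y \<in> set vs \<and> (x, y) \<in> parcs \<Gamma>. f y) = k * f x" if "x \<in> set vs" for x
  proof -
    have x: "x \<in> {0..<m}" using that vs by simp
    have nbrs: "{y. y \<in> set vs \<and> (x, y) \<in> parcs \<Gamma>} =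
        {y \<in> {0..<m}. x \<noteq> y \<and> \<not> m dvd x + y \<and> q dvd x + y}"
      using arcs[OF x] vs by auto
    \<comment> \<open>Both summands lie in \<open>{0..<m}\<close>, so
      \<open>0 \<le> x + y < 2 * m\<close> and the quotient by \<open>m\<close> is 0 or 1.\<close>
    have opposite: "m dvd x + y \<longleftrightarrow> x + y = 0 \<or> x + y = m" if "y \<in> {0..<m}" for y
    proof
      assume "m dvd x + y"
      then obtain c where c: "x + y = m * c" ..
      then have "m * 0 \<le> m * c" "m * c < m * 2"
        unfolding c[symmetric] using x that by simp_all
      then have "c = 0 \<or> c = 1"
        using m by (simp only: mult_le_cancel_left_pos mult_less_cancel_left_pos) auto
      then show "x + y = 0 \<or> x + y = m" using c by auto
    qed auto
    consider "x \<notin> S" | "x = 0" | "x \<in> S" "x \<noteq> 0" by blast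
    then show ?thesis
    proof cases
      \<comment> \<open>Neighbours of a vertex outside \<open>S\<close> are also outside
        \<open>S\<close>, so both sides vanish.\<close>
      case 1
      then have "\<not> q dvd x" using x by (simp add: S_def)
      then have "y \<notin> S" if "q dvd x + y" for y
        using that dvd_add_left_iff[of q y x] by (auto simp: S_def)
      then have "(\<Sum>y | y \<in> set vs \<and> (x, y) \<in> parcs \<Gamma>. f y) = 0"
        unfolding nbrs using S0 by (intro sum.neutral) (auto simp: f_def)
      moreover have "f x = 0"
        using 1 S0 by (auto simp: f_def)
      ultimately show ?thesis by simp
    next
      case 2
      then have "{y. y \<in> set vs \<and> (x, y) \<in> parcs \<Gamma>} = S - {0}"
        unfolding nbrs using opposite by (auto simp: S_def)
      then show ?thesis
        using 2 ka sum_rest by (simp add: f_def)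
    next
      case 3
      then have "q dvd x + y \<longleftrightarrow> q dvd y" for y
        by (simp add: S_def dvd_add_right_iff)
      moreover have "x + y \<noteq> 0" if "y \<in> {0..<m}" for y
        using 3 x that by auto
      ultimately have nbrs': "{y. y \<in> set vs \<and> (x, y) \<in> parcs \<Gamma>} = S - {x, m - x}"
        unfolding nbrs using opposite by (auto simp: S_def)
      \<comment> \<open>\<open>m - x\<close> represents the inverse of \<open>x\<close>. It differs
        from \<open>x\<close> because \<open>m\<close> is odd, so exactly two vertices of value 1
        are removed from \<open>S\<close>, leaving the sum
        \<open>a + (p - 1) - 2 = k\<close>.\<close>
      have mx: "m - x \<in> S" "m - x \<noteq> 0" "m - x \<noteq> x"
        using 3 qm \<open>odd m\<close> by (auto simp: S_def)
      have "sum f S = a + (real p - 1)"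
        using sum.remove[OF fin_S S0, of f] sum_rest by (simp add: f_def)
      moreover have "sum f (S - {x, m - x}) = sum f S - sum f {x, m - x}"
        using 3 mx fin_S by (intro sum_diff) auto
      moreover have "sum f {x, m - x} = 2"
        using 3 mx by (simp add: f_def)
      ultimately show ?thesis
        unfolding nbrs' using 3 by (simp add: f_def a_def)
    qed
  qed
  \<comment> \<open>\<open>k * a = p - 1 > 0\<close> rules out \<open>a = 0\<close>.\<close>
  moreover have "f 0 \<noteq> 0"
    using ka p3 by (auto simp: f_def)
  moreover have "0 \<in> set vs"
    using vs m by simp
  ultimately have "eigenvalue (adjacency_mat \<Gamma> vs) k"
    using assms(4) by (intro eigenvalue_adjacency_matI)
  then show ?thesis
    using irr unfolding \<Gamma>_def by blast
qed

end
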